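(* Let $\mathbb{G}(\overline{C}_5)$ and $\mathbb{G}(\overline{P}_7)$ be the partially commutative groups given by $$\mathbb{G}(\overline{C}_5)=\langle a,b,c,d,e\mid [a,c],[a,d],[b,d],[b,e],[c,e]\rangle$$ and $$\begin{aligned}\mathbb{G}(\overline{P}_7)=\langle a,b,c_1,c_2,d_1,d_2,e_1,e_2\mid\ &[a,c_1],[a,c_2],[a,d_1],[a,d_2],[a,e_2],\\ &[b,c_1],[b,d_1],[b,d_2],[b,e_1],[b,e_2],\\ &[c_1,c_2],[c_1,d_2],[c_1,e_1],[c_1,e_2],\\ &[c_2,d_1],[c_2,e_1],[c_2,e_2],\\ &[d_1,d_2],[d_1,e_2],[d_2,e_1],[e_1,e_2]\rangle.\end{aligned}$$ Then the map $\varphi$ defined on generators by $a\mapsto a$, $b\mapsto b$, $c\mapsto c_1c_2$, $d\mapsto d_1d_2$, $e\mapsto e_1e_2$ induces an embedding (injective group homomorphism) of $\mathbb{G}(\overline{C}_5)$ into $\mathbb{G}(\overline{P}_7)$.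
   Context: For elements $g,h$ of a group, $[g,h]=g^{-1}h^{-1}gh$. For a simple undirected graph $\Gamma$ with vertex set $X$ and edge set $E$, the partially commutative group with commutation graph $\Gamma$ is $\mathbb{G}(\Gamma)=\langle X\mid [x,y],\ \{x,y\}\in E\rangle$. $\overline{\Gamma}$ denotes the complement graph of $\Gamma$. $C_5$ is the cycle graph on $5$ vertices and $P_7$ the path graph with $7$ edges (and $8$ vertices). In the presentations in the claim, the non-commutation graphs (the complements of the commutation graphs) are, respectively, the $5$-cycle with vertices in cyclic order $a,b,c,d,e$, and the path with vertices in order $c_1,d_1,e_1,a,b,c_2,d_2,e_2$. *)

theory Defs
  imports "HOL-Algebra.Group"
begin

section \<open>Groups given by generators and relators\<close>

text \<open>A word is a list of letters; \<open>(x, True)\<close> stands for the generator \<open>x\<close> and \<open>(x, False)\<close>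
  for its formal inverse.\<close>

type_synonym 'a word = "('a \<times> bool) list"

definition words :: "'a set \<Rightarrow> 'a word set" where
  "words X = lists (X \<times> UNIV)"

definition letter :: "'a \<Rightarrow> 'a word" where
  "letter x = [(x, True)]"

definition inv_word :: "'a word \<Rightarrow> 'a word" where
  "inv_word w = rev (map (\<lambda>(x, s). (x, \<not> s)) w)"

definition comm_word :: "'a word \<Rightarrow> 'a word \<Rightarrow> 'a word" where
  "comm_word g h = inv_word g @ inv_word h @ g @ h"

text \<open>Two words over \<open>X\<close> represent the same element of the group \<open>\<langle>X | R\<rangle>\<close> iff one can be
  transformed into the other by inserting and deleting subwords that are relators or of the form
  \<open>x x\<^sup>-\<^sup>1\<close>, \<open>x\<^sup>-\<^sup>1 x\<close>. Here \<open>R\<close> is meant to consist of words over \<open>X\<close>.\<close>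

inductive pres_eq :: "'a set \<Rightarrow> 'a word set \<Rightarrow> 'a word \<Rightarrow> 'a word \<Rightarrow> bool"
  for X :: "'a set" and R :: "'a word set" where
  refl: "w \<in> words X \<Longrightarrow> pres_eq X R w w"
| sym: "pres_eq X R u v \<Longrightarrow> pres_eq X R v u"
| trans: "pres_eq X R u v \<Longrightarrow> pres_eq X R v w \<Longrightarrow> pres_eq X R u w"
| cancel: "u \<in> words X \<Longrightarrow> v \<in> words X \<Longrightarrow> x \<in> X \<Longrightarrow> pres_eq X R (u @ [(x, s), (x, \<not> s)] @ v) (u @ v)"
| relator: "u \<in> words X \<Longrightarrow> v \<in> words X \<Longrightarrow> r \<in> R \<Longrightarrow> pres_eq X R (u @ r @ v) (u @ v)"

definition pres_rel :: "'a set \<Rightarrow> 'a word set \<Rightarrow> ('a word \<times> 'a word) set" where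
  "pres_rel X R = {(u, v). pres_eq X R u v}"

definition presented_group :: "'a set \<Rightarrow> 'a word set \<Rightarrow> 'a word set monoid" where
  "presented_group X R =
     \<lparr>carrier = words X // pres_rel X R,
      mult = (\<lambda>P Q. \<Union>u\<in>P. \<Union>v\<in>Q. pres_rel X R `` {u @ v}),
      one = pres_rel X R `` {[]}\<rparr>"

definition pres_gen :: "'a set \<Rightarrow> 'a word set \<Rightarrow> 'a \<Rightarrow> 'a word set" where
  "pres_gen X R x = pres_rel X R `` {letter x}"

lemma words_append [simp]: "u @ v \<in> words X \<longleftrightarrow> u \<in> words X \<and> v \<in> words X"
  by (auto simp: words_def)

lemma words_Nil [simp]: "[] \<in> words X"
  by (auto simp: words_def)

lemma words_Cons [simp]: "p # v \<in> words X \<longleftrightarrow> fst p \<in> X \<and> v \<in> words X"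
  by (cases p) (auto simp: words_def)

lemma words_inv [simp]: "inv_word w \<in> words X \<longleftrightarrow> w \<in> words X"
  by (induction w) (auto simp: inv_word_def)

lemma words_letter [simp]: "letter x \<in> words X \<longleftrightarrow> x \<in> X"
  by (simp add: letter_def)

lemma words_comm [simp]: "comm_word g h \<in> words X \<longleftrightarrow> g \<in> words X \<and> h \<in> words X"
  by (auto simp: comm_word_def)

lemma pres_eq_words:
  assumes "pres_eq X R u v" "R \<subseteq> words X"
  shows "u \<in> words X \<and> v \<in> words X"
  using assms by induction auto

lemma pres_eq_context:
  assumes "pres_eq X R u v" "a \<in> words X" "b \<in> words X"
  shows "pres_eq X R (a @ u @ b) (a @ v @ b)"
  using assms
proof induction
  case (refl w)
  then show ?case by (intro pres_eq.refl) auto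
next
  case (sym u v)
  then show ?case by (blast intro: pres_eq.sym)
next
  case (trans u v w)
  then show ?case by (blast intro: pres_eq.trans)
next
  case (cancel u v x s)
  then show ?case using pres_eq.cancel[of "a @ u" X "v @ b" x R s] by auto
next
  case (relator u v r)
  then show ?case using pres_eq.relator[of "a @ u" X "v @ b" r R] by auto
qed

lemma pres_eq_append:
  assumes "pres_eq X R u u'" "pres_eq X R v v'" "R \<subseteq> words X"
  shows "pres_eq X R (u @ v) (u' @ v')"
proof -
  have "pres_eq X R (u @ v) (u' @ v)"
    using pres_eq_context[OF assms(1), of "[]" v] pres_eq_words[OF assms(2,3)] by simp
  moreover have "pres_eq X R (u' @ v) (u' @ v')"
    using pres_eq_context[OF assms(2), of u' "[]"] pres_eq_words[OF assms(1,3)] by simp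
  ultimately show ?thesis by (rule pres_eq.trans)
qed

lemma pres_eq_inv_left: "w \<in> words X \<Longrightarrow> pres_eq X R (inv_word w @ w) []"
proof (induction w)
  case Nil
  then show ?case by (auto simp: inv_word_def intro: pres_eq.refl)
next
  case (Cons p w)
  obtain x s where p: "p = (x, s)" by (cases p)
  have "pres_eq X R (inv_word w @ [(x, \<not> s), (x, \<not> \<not> s)] @ w) (inv_word w @ w)"
    using Cons.prems p by (intro pres_eq.cancel) auto
  then have "pres_eq X R (inv_word (p # w) @ p # w) (inv_word w @ w)"
    by (simp add: p inv_word_def)
  then show ?case using Cons pres_eq.trans by fastforce
qed

lemma equiv_pres_rel:
  assumes "R \<subseteq> words X"
  shows "equiv (words X) (pres_rel X R)"
  using pres_eq_words[OF _ assms] pres_eq.refl pres_eq.sym pres_eq.trans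
  unfolding equiv_def refl_on_def sym_def trans_def pres_rel_def by blast

lemma mult_presented_group:
  assumes R: "R \<subseteq> words X" and uv: "u \<in> words X" "v \<in> words X"
  shows "pres_rel X R `` {u} \<otimes>\<^bsub>presented_group X R\<^esub> pres_rel X R `` {v} = pres_rel X R `` {u @ v}"
proof -
  note eq = equiv_pres_rel[OF R]
  have "congruent2 (pres_rel X R) (pres_rel X R) (\<lambda>u v. pres_rel X R `` {u @ v})"
    unfolding congruent2_def
    using equiv_class_eq[OF eq] pres_eq_append[OF _ _ R] by (auto simp: pres_rel_def)
  from UN_equiv_class2[OF eq eq this uv] show ?thesis
    by (simp add: presented_group_def)
qed

lemma group_presented_group:
  assumes R: "R \<subseteq> words X"
  shows "group (presented_group X R)"
proof -
  let ?G = "presented_group X R"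
  let ?c = "\<lambda>w. pres_rel X R `` {w}"
  note eq = equiv_pres_rel[OF R]
  have car: "carrier ?G = ?c ` words X"
    by (auto simp: presented_group_def quotient_def)
  have one: "\<one>\<^bsub>?G\<^esub> = ?c []" by (simp add: presented_group_def)
  note mult = mult_presented_group[OF R]
  show ?thesis
  proof (rule groupI)
    fix x assume "x \<in> carrier ?G"
    then obtain u where u: "u \<in> words X" "x = ?c u" unfolding car by blast
    have "?c (inv_word u) \<otimes>\<^bsub>?G\<^esub> x = \<one>\<^bsub>?G\<^esub>"
      using u equiv_class_eq[OF eq, of "inv_word u @ u" "[]"] pres_eq_inv_left[of u X R]
      by (simp add: mult one) (simp add: pres_rel_def)
    then show "\<exists>y\<in>carrier ?G. y \<otimes>\<^bsub>?G\<^esub> x = \<one>\<^bsub>?G\<^esub>" using u unfolding car by auto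
  qed (auto simp: car one mult)
qed

lemma presented_group_cong:
  assumes R: "R \<subseteq> words X" and S: "S \<subseteq> words X"
    and RS: "\<And>r. r \<in> R \<Longrightarrow> pres_eq X S r []" and SR: "\<And>r. r \<in> S \<Longrightarrow> pres_eq X R r []"
  shows "pres_rel X R = pres_rel X S" "presented_group X R = presented_group X S"
proof -
  have *: "pres_eq X R' u v"
    if "pres_eq X S' u v" "\<And>r. r \<in> S' \<Longrightarrow> pres_eq X R' r []" for u v R' S'
    using that
  proof induction
    case (relator u v r)
    then show ?case using pres_eq_context[of X R' r "[]" u v] by simp
  qed (blast intro: pres_eq.intros)+
  show 1: "pres_rel X R = pres_rel X S"
    using *[of R _ _ S] *[of S _ _ R] RS SR unfolding pres_rel_def by blast
  show "presented_group X R = presented_group X S"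
    unfolding presented_group_def 1 ..
qed

section \<open>Graphs and partially commutative groups\<close>

text \<open>A simple undirected graph is given by its vertex set and its set of two-element edges.\<close>

type_synonym 'a ugraph = "'a set \<times> 'a set set"

definition simple_graph :: "'a ugraph \<Rightarrow> bool" where
  "simple_graph \<Gamma> \<longleftrightarrow> (\<forall>e\<in>snd \<Gamma>. e \<subseteq> fst \<Gamma> \<and> card e = 2)"

definition graph_complement :: "'a ugraph \<Rightarrow> 'a ugraph" where
  "graph_complement \<Gamma> = (fst \<Gamma>, {e. e \<subseteq> fst \<Gamma> \<and> card e = 2 \<and> e \<notin> snd \<Gamma>})"

definition path_graph :: "'a list \<Rightarrow> 'a ugraph" where
  "path_graph xs = (set xs, {{xs ! i, xs ! Suc i} | i. Suc i < length xs})"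

definition cycle_graph :: "'a list \<Rightarrow> 'a ugraph" where
  "cycle_graph xs = (set xs, insert {last xs, hd xs} (snd (path_graph xs)))"

text \<open>Each edge contributes both \<open>[x, y]\<close> and \<open>[y, x]\<close>; these are inverse to each other, so one of
  the two is redundant.\<close>

definition pc_rels :: "'a ugraph \<Rightarrow> 'a word set" where
  "pc_rels \<Gamma> = {comm_word (letter x) (letter y) | x y. {x, y} \<in> snd \<Gamma>}"

definition pc_group :: "'a ugraph \<Rightarrow> 'a word set monoid" where
  "pc_group \<Gamma> = presented_group (fst \<Gamma>) (pc_rels \<Gamma>)"

lemma inv_comm_word: "inv_word (comm_word (letter x) (letter y)) = comm_word (letter y) (letter x)"
  by (simp add: inv_word_def comm_word_def letter_def)

lemma pc_group_one_sided:
  assumes "simple_graph (V, (\<lambda>(x, y). {x, y}) ` P)"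
  defines "S \<equiv> (\<lambda>(x, y). comm_word (letter x) (letter y)) ` P"
  shows "pres_rel V (pc_rels (V, (\<lambda>(x, y). {x, y}) ` P)) = pres_rel V S"
    and "pc_group (V, (\<lambda>(x, y). {x, y}) ` P) = presented_group V S"
proof -
  let ?R = "pc_rels (V, (\<lambda>(x, y). {x, y}) ` P)"
  have P: "x \<in> V" "y \<in> V" if "(x, y) \<in> P" for x y
    using assms(1) that by (auto simp: simple_graph_def)
  have S: "S \<subseteq> words V" using P by (auto simp: S_def)
  have R: "?R \<subseteq> words V" using P by (auto simp: pc_rels_def doubleton_eq_iff)
  have SR: "S \<subseteq> ?R" by (auto simp: S_def pc_rels_def)
  have 1: "pres_eq V T r []" if "r \<in> T" for T :: "'a word set" and r
    using pres_eq.relator[of "[]" V "[]" r T] that by simp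
  have 2: "pres_eq V S (comm_word (letter y) (letter x)) []" if "(x, y) \<in> P" for x y
  proof -
    let ?w = "comm_word (letter x) (letter y)"
    have w: "?w \<in> S" using that by (force simp: S_def)
    then have "pres_eq V S (inv_word ?w @ ?w @ []) (inv_word ?w @ [])"
      using S by (intro pres_eq.relator) auto
    moreover have "pres_eq V S (inv_word ?w @ ?w) []"
      using w S by (intro pres_eq_inv_left) auto
    ultimately have "pres_eq V S (inv_word ?w) []"
      by (simp) (meson pres_eq.sym pres_eq.trans)
    then show ?thesis by (simp add: inv_comm_word)
  qed
  have RS: "pres_eq V S r []" if "r \<in> ?R" for r
    using that 2 1[of _ S] unfolding pc_rels_def S_def
    by (fastforce simp: doubleton_eq_iff)
  show "pres_rel V ?R = pres_rel V S"
    using presented_group_cong(1)[OF R S RS] 1 SR by blast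
  show "pc_group (V, (\<lambda>(x, y). {x, y}) ` P) = presented_group V S"
    using presented_group_cong(2)[OF R S RS] 1 SR by (auto simp: pc_group_def)
qed

section \<open>The two presentations\<close>

abbreviation commr :: "'a \<Rightarrow> 'a \<Rightarrow> 'a word" where
  "commr x y \<equiv> comm_word (letter x) (letter y)"

datatype c5_gen = Ga | Gb | Gc | Gd | Ge

datatype p7_gen = Ha | Hb | Hc1 | Hc2 | Hd1 | Hd2 | He1 | He2

definition C5c_gens :: "c5_gen set" where
  "C5c_gens = {Ga, Gb, Gc, Gd, Ge}"

definition C5c_rels :: "c5_gen word set" where
  "C5c_rels = {commr Ga Gc, commr Ga Gd, commr Gb Gd, commr Gb Ge, commr Gc Ge}"

definition P7c_gens :: "p7_gen set" where
  "P7c_gens = {Ha, Hb, Hc1, Hc2, Hd1, Hd2, He1, He2}"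

definition P7c_rels :: "p7_gen word set" where
  "P7c_rels =
    {commr Ha Hc1, commr Ha Hc2, commr Ha Hd1, commr Ha Hd2, commr Ha He2,
     commr Hb Hc1, commr Hb Hd1, commr Hb Hd2, commr Hb He1, commr Hb He2,
     commr Hc1 Hc2, commr Hc1 Hd2, commr Hc1 He1, commr Hc1 He2,
     commr Hc2 Hd1, commr Hc2 He1, commr Hc2 He2,
     commr Hd1 Hd2, commr Hd1 He2, commr Hd2 He1, commr He1 He2}"

definition G_C5c :: "c5_gen word set monoid" where
  "G_C5c = presented_group C5c_gens C5c_rels"

definition G_P7c :: "p7_gen word set monoid" where
  "G_P7c = presented_group P7c_gens P7c_rels"

abbreviation gen_C5c :: "c5_gen \<Rightarrow> c5_gen word set" where
  "gen_C5c \<equiv> pres_gen C5c_gens C5c_rels"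

abbreviation gen_P7c :: "p7_gen \<Rightarrow> p7_gen word set" where
  "gen_P7c \<equiv> pres_gen P7c_gens P7c_rels"

text \<open>The explicit presentations are those of the partially commutative groups whose
  non-commutation graphs are the 5-cycle and the path with 7 edges.\<close>

lemma card_2_subset_list:
  "{e. e \<subseteq> set xs \<and> card e = 2 \<and> e \<notin> E} =
   (\<lambda>(x, y). {x, y}) ` set (filter (\<lambda>(x, y). x \<noteq> y \<and> {x, y} \<notin> E) (List.product xs xs))"
  by (auto simp: card_2_iff image_iff)

lemma path_graph_simps:
  "snd (path_graph [x]) = {}"
  "snd (path_graph (x # y # xs)) = insert {x, y} (snd (path_graph (y # xs)))"
proof -
  show "snd (path_graph [x]) = {}" by (simp add: path_graph_def)
  have "{{(x # y # xs) ! i, (x # y # xs) ! Suc i} |i. Suc i < length (x # y # xs)} =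
        insert {x, y} {{(y # xs) ! i, (y # xs) ! Suc i} |i. Suc i < length (y # xs)}"
    (is "?L = ?R")
  proof
    show "?L \<subseteq> ?R"
    proof
      fix e assume "e \<in> ?L"
      then obtain i where i: "e = {(x # y # xs) ! i, (x # y # xs) ! Suc i}"
        "Suc i < length (x # y # xs)" by blast
      then show "e \<in> ?R" by (cases i) auto
    qed
    show "?R \<subseteq> ?L"
    proof
      fix e assume "e \<in> ?R"
      then consider "e = {x, y}" | i where "e = {(y # xs) ! i, (y # xs) ! Suc i}" "Suc i < length (y # xs)"
        by blast
      then show "e \<in> ?L"
      proof cases
        case 1
        then show ?thesis by (intro CollectI exI[of _ 0]) auto
      next
        case (2 i)
        then show ?thesis by (intro CollectI exI[of _ "Suc i"]) auto
      qed
    qed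
  qed
  then show "snd (path_graph (x # y # xs)) = insert {x, y} (snd (path_graph (y # xs)))"
    by (simp add: path_graph_def)
qed

definition C5 :: "c5_gen ugraph" where
  "C5 = cycle_graph [Ga, Gb, Gc, Gd, Ge]"

definition P7 :: "p7_gen ugraph" where
  "P7 = path_graph [Hc1, Hd1, He1, Ha, Hb, Hc2, Hd2, He2]"

lemma complement_C5:
  "graph_complement C5 = (C5c_gens, (\<lambda>(x, y). {x, y}) `
     {(Ga, Gc), (Ga, Gd), (Gb, Gd), (Gb, Ge), (Gc, Ge)})"
proof -
  have V: "fst C5 = set [Ga, Gb, Gc, Gd, Ge]" by (simp add: C5_def cycle_graph_def)
  have E: "snd C5 = {{Ga, Gb}, {Gb, Gc}, {Gc, Gd}, {Gd, Ge}, {Ge, Ga}}"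
    by (auto simp: C5_def cycle_graph_def path_graph_simps)
  show ?thesis
    unfolding graph_complement_def V card_2_subset_list C5c_gens_def unfolding E
    by (simp add: doubleton_eq_iff insert_commute)
qed

lemma complement_P7:
  "graph_complement P7 = (P7c_gens, (\<lambda>(x, y). {x, y}) `
     {(Ha, Hc1), (Ha, Hc2), (Ha, Hd1), (Ha, Hd2), (Ha, He2),
      (Hb, Hc1), (Hb, Hd1), (Hb, Hd2), (Hb, He1), (Hb, He2),
      (Hc1, Hc2), (Hc1, Hd2), (Hc1, He1), (Hc1, He2),
      (Hc2, Hd1), (Hc2, He1), (Hc2, He2),
      (Hd1, Hd2), (Hd1, He2), (Hd2, He1), (He1, He2)})"
proof -
  have V: "fst P7 = set [Hc1, Hd1, He1, Ha, Hb, Hc2, Hd2, He2]" by (simp add: P7_def path_graph_def)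
  have E: "snd P7 = {{Hc1, Hd1}, {Hd1, He1}, {He1, Ha}, {Ha, Hb}, {Hb, Hc2}, {Hc2, Hd2}, {Hd2, He2}}"
    by (simp add: P7_def path_graph_simps)
  show ?thesis
    unfolding graph_complement_def V card_2_subset_list P7c_gens_def unfolding E
    by (simp add: doubleton_eq_iff) (auto simp: insert_commute)
qed

lemma simple_graph_complement: "simple_graph (graph_complement \<Gamma>)"
  by (auto simp: simple_graph_def graph_complement_def)

lemma G_C5c_eq: "G_C5c = pc_group (graph_complement C5)"
  using pc_group_one_sided(2)[OF simple_graph_complement[of C5, unfolded complement_C5]]
  by (simp add: complement_C5 G_C5c_def C5c_rels_def)

lemma G_P7c_eq: "G_P7c = pc_group (graph_complement P7)"
  using pc_group_one_sided(2)[OF simple_graph_complement[of P7, unfolded complement_P7]]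
  by (simp add: complement_P7 G_P7c_def P7c_rels_def)

lemma group_G_C5c: "group G_C5c"
  unfolding G_C5c_def by (rule group_presented_group) (auto simp: C5c_rels_def C5c_gens_def)

lemma group_G_P7c: "group G_P7c"
  unfolding G_P7c_def by (rule group_presented_group) (auto simp: P7c_rels_def P7c_gens_def)

end

theory Submission
  imports Defs
begin

text \<open>By Britton's lemma, a word that contains \<open>x\<close> but whose value does not involve \<open>x\<close> has a
  pinch \<open>x\<^sup>\<plusminus>\<^sup>1 m x\<^sup>\<minusplus>\<^sup>1\<close>: here \<open>m\<close> avoids \<open>x\<close> and its value lies in the subgroup generated
  by the other generators commuting with \<open>x\<close>. Let \<open>w\<close> be a reduced word of the group of the
  5-cycle whose image is trivial.

  If \<open>a\<close> occurs in \<open>w\<close>, the image has a pinch at \<open>a\<close>, the image of \<open>a\<^sup>\<plusminus>\<^sup>1 m a\<^sup>\<minusplus>\<^sup>1\<close>, and \<open>m\<close>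
  contains \<open>b\<close> or \<open>e\<close> as \<open>w\<close> is reduced. If it contains \<open>b\<close>, retract onto the path
  \<open>a, b, c\<^sub>2, d\<^sub>2, e\<^sub>2\<close>: there the value of \<open>m\<close> does not involve \<open>b\<close>, so \<open>m\<close> has a pinch at
  \<open>b\<close>, which must contain \<open>c\<close>, hence a pinch at \<open>c\<close>, and so on; the innermost pinch, at \<open>e\<close>,
  contradicts that \<open>w\<close> is reduced. If \<open>m\<close> contains no \<open>b\<close>, run along \<open>a, e\<^sub>1, d\<^sub>1, c\<^sub>1\<close> instead;
  that \<open>c\<^sub>1\<close> and \<open>b\<close> now commute does no harm. If \<open>a\<close> does not occur in \<open>w\<close>, the first path
  works from its first vertex that occurs.\<close>

section \<open>Words and substitutions\<close>

abbreviation letters :: "'a word \<Rightarrow> 'a set" where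
  "letters w \<equiv> fst ` set w"

lemma words_iff_letters: "w \<in> words X \<longleftrightarrow> letters w \<subseteq> X"
  by (induction w) auto

lemma inv_word_Nil [simp]: "inv_word [] = []"
  and inv_word_append [simp]: "inv_word (u @ v) = inv_word v @ inv_word u"
  and inv_word_Cons: "inv_word ((x, s) # w) = inv_word w @ [(x, \<not> s)]"
  by (simp_all add: inv_word_def)

lemma inv_word_inv_word [simp]: "inv_word (inv_word w) = w"
  by (simp add: inv_word_def rev_map[symmetric] o_def case_prod_beta)

lemma letters_inv_word [simp]: "letters (inv_word w) = letters w"
  by (simp add: inv_word_def image_image case_prod_beta)

definition subst_word :: "('a \<Rightarrow> 'b word) \<Rightarrow> 'a word \<Rightarrow> 'b word" where
  "subst_word f w = concat (map (\<lambda>(x, s). if s then f x else inv_word (f x)) w)"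

lemma subst_word_Nil [simp]: "subst_word f [] = []"
  and subst_word_append [simp]: "subst_word f (u @ v) = subst_word f u @ subst_word f v"
  and subst_word_Cons [simp]:
    "subst_word f ((x, s) # w) = (if s then f x else inv_word (f x)) @ subst_word f w"
  by (simp_all add: subst_word_def)

lemma letters_subst_word: "letters (subst_word f w) = (\<Union>x\<in>letters w. letters (f x))"
proof (induction w)
  case (Cons p w)
  then show ?case by (cases p) (simp add: image_Un)
qed simp

lemma subst_word_in_words:
  "\<lbrakk>\<And>x. x \<in> X \<Longrightarrow> f x \<in> words Y; w \<in> words X\<rbrakk> \<Longrightarrow> subst_word f w \<in> words Y"
  by (induction w) auto

lemma subst_word_inv_word: "subst_word f (inv_word w) = inv_word (subst_word f w)"
  by (induction w) (auto simp: inv_word_Cons)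

lemma subst_word_comm_word:
  "subst_word f (comm_word (letter x) (letter y)) = comm_word (f x) (f y)"
  by (simp add: comm_word_def letter_def inv_word_Cons)

section \<open>Calculations with presentations\<close>

declare pres_eq.trans [trans]

lemma pres_eq_inv_right: "w \<in> words X \<Longrightarrow> pres_eq X R (w @ inv_word w) []"
  using pres_eq_inv_left[of "inv_word w" X R] by simp

lemma pres_eq_cancel_inv_right:
  assumes "u \<in> words X" "w \<in> words X" "v \<in> words X"
  shows "pres_eq X R (u @ w @ inv_word w @ v) (u @ v)"
  using pres_eq_context[OF pres_eq_inv_right[OF assms(2), of R] assms(1,3)] by simp

lemma pres_eq_cancel_inv_left:
  assumes "u \<in> words X" "w \<in> words X" "v \<in> words X"
  shows "pres_eq X R (u @ inv_word w @ w @ v) (u @ v)"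
  using pres_eq_context[OF pres_eq_inv_left[OF assms(2), of R] assms(1,3)] by simp

lemma pres_eq_append_left_cancel:
  assumes "pres_eq X R (c @ u) (c @ v)" "c \<in> words X" "u \<in> words X" "v \<in> words X"
  shows "pres_eq X R u v"
proof -
  have "pres_eq X R u (inv_word c @ c @ u)"
    using pres_eq_cancel_inv_left[of "[]" X c u R] assms by (auto intro: pres_eq.sym)
  also have "pres_eq X R (inv_word c @ c @ u) (inv_word c @ c @ v)"
    using pres_eq_context[OF assms(1), of "inv_word c" "[]"] assms(2) by simp
  also have "pres_eq X R (inv_word c @ c @ v) v"
    using pres_eq_cancel_inv_left[of "[]" X c v R] assms by simp
  finally show ?thesis .
qed

lemma pres_eq_inv_word_iff:
  assumes R: "R \<subseteq> words X" and uv: "u \<in> words X" "v \<in> words X"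
  shows "pres_eq X R (u @ inv_word v) [] \<longleftrightarrow> pres_eq X R u v"
proof
  assume "pres_eq X R (u @ inv_word v) []"
  from pres_eq_context[OF this, of "[]" v] uv have *: "pres_eq X R (u @ inv_word v @ v) v" by simp
  have "pres_eq X R u (u @ inv_word v @ v)"
    using pres_eq_cancel_inv_left[of u X v "[]" R] uv by (auto intro: pres_eq.sym)
  also note *
  finally show "pres_eq X R u v" .
next
  assume "pres_eq X R u v"
  from pres_eq_context[OF this, of "[]" "inv_word v"] uv
  have "pres_eq X R (u @ inv_word v) (v @ inv_word v)" by simp
  also have "pres_eq X R (v @ inv_word v) []"
    using uv by (intro pres_eq_inv_right)
  finally show "pres_eq X R (u @ inv_word v) []" .
qed

lemma pres_eq_comm_word_iff:
  assumes R: "R \<subseteq> words X" and gh: "g \<in> words X" "h \<in> words X"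
  shows "pres_eq X R (comm_word g h) [] \<longleftrightarrow> pres_eq X R (g @ h) (h @ g)"
proof
  assume "pres_eq X R (comm_word g h) []"
  then have "pres_eq X R (h @ g) (h @ g @ comm_word g h)"
    using pres_eq_context[of X R "comm_word g h" "[]" "h @ g" "[]"] gh by (auto intro: pres_eq.sym)
  also have "pres_eq X R (h @ g @ comm_word g h) (h @ inv_word h @ g @ h)"
    using pres_eq_cancel_inv_right[of h X g "inv_word h @ g @ h" R] gh by (simp add: comm_word_def)
  also have "pres_eq X R (h @ inv_word h @ g @ h) (g @ h)"
    using pres_eq_cancel_inv_right[of "[]" X h "g @ h" R] gh by simp
  finally show "pres_eq X R (g @ h) (h @ g)" by (rule pres_eq.sym)
next
  assume "pres_eq X R (g @ h) (h @ g)"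
  then have "pres_eq X R (comm_word g h) (inv_word g @ inv_word h @ h @ g)"
    using pres_eq_context[of X R "g @ h" "h @ g" "inv_word g @ inv_word h" "[]"] gh
    by (simp add: comm_word_def)
  also have "pres_eq X R (inv_word g @ inv_word h @ h @ g) (inv_word g @ g)"
    using pres_eq_cancel_inv_left[of "inv_word g" X h g R] gh by simp
  also have "pres_eq X R (inv_word g @ g) []"
    using gh by (intro pres_eq_inv_left)
  finally show "pres_eq X R (comm_word g h) []" .
qed

lemma pres_eq_commute_inv:
  assumes gh: "g \<in> words X" "h \<in> words X" and "pres_eq X R (g @ h) (h @ g)"
  shows "pres_eq X R (inv_word g @ h) (h @ inv_word g)"
proof -
  have "pres_eq X R (inv_word g @ h) (inv_word g @ h @ g @ inv_word g)"
    using pres_eq_cancel_inv_right[of "inv_word g @ h" X g "[]" R] gh by (auto intro: pres_eq.sym)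
  also have "pres_eq X R (inv_word g @ h @ g @ inv_word g) (inv_word g @ g @ h @ inv_word g)"
    using pres_eq_context[OF pres_eq.sym[OF assms(3)], of "inv_word g" "inv_word g"] gh by simp
  also have "pres_eq X R (inv_word g @ g @ h @ inv_word g) (h @ inv_word g)"
    using pres_eq_cancel_inv_left[of "[]" X g "h @ inv_word g" R] gh by simp
  finally show ?thesis .
qed

text \<open>Von Dyck's theorem: a derivation is carried over step by step, a cancelling pair
  becoming a word next to its inverse.\<close>

lemma pres_eq_subst_word:
  assumes "pres_eq X R u v"
    and f: "\<And>x. x \<in> X \<Longrightarrow> f x \<in> words Y"
    and R: "\<And>r. r \<in> R \<Longrightarrow> pres_eq Y S (subst_word f r) []"
  shows "pres_eq Y S (subst_word f u) (subst_word f v)"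
  using assms(1)
proof induction
  case (refl w)
  then show ?case by (intro pres_eq.refl subst_word_in_words[OF f])
next
  case (cancel u v x s)
  then have uv: "subst_word f u \<in> words Y" "subst_word f v \<in> words Y"
    using subst_word_in_words f by blast+
  show ?case
    using pres_eq_cancel_inv_left[OF uv(1) f uv(2), of x S]
      pres_eq_cancel_inv_right[OF uv(1) f uv(2), of x S] cancel(3)
    by (cases s) auto
next
  case (relator u v r)
  then have "subst_word f u \<in> words Y" "subst_word f v \<in> words Y"
    using subst_word_in_words f by blast+
  then show ?case using pres_eq_context[OF R[OF relator(3)]] by simp
qed (blast intro: pres_eq.intros)+

section \<open>Partially commutative presentations\<close>

text \<open>One relator per ordered pair, as in the explicit presentations; \<open>comm_with\<close>
  symmetrises the relation and leaves out \<open>x\<close> itself.\<close>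

definition comm_rels :: "('a \<times> 'a) set \<Rightarrow> 'a word set" where
  "comm_rels E = (\<lambda>(x, y). comm_word (letter x) (letter y)) ` E"

definition comm_with :: "('a \<times> 'a) set \<Rightarrow> 'a \<Rightarrow> 'a set" where
  "comm_with E x = {y. y \<noteq> x \<and> ((x, y) \<in> E \<or> (y, x) \<in> E)}"

lemma comm_rels_words: "E \<subseteq> X \<times> X \<Longrightarrow> comm_rels E \<subseteq> words X"
  by (auto simp: comm_rels_def)

text \<open>The relator settles two positive letters; inverting first one letter and then the other
  by \<open>pres_eq_commute_inv\<close> gives all signs.\<close>

lemma comm_rels_swap:
  assumes E: "E \<subseteq> X \<times> X" and "(x, y) \<in> E \<or> (y, x) \<in> E"
  shows "pres_eq X (comm_rels E) [(x, s), (y, t)] [(y, t), (x, s)]"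
proof -
  note R = comm_rels_words[OF E]
  have XY: "x \<in> X" "y \<in> X" using assms by auto
  have pos: "pres_eq X (comm_rels E) (letter a @ letter b) (letter b @ letter a)" if "(a, b) \<in> E" for a b
  proof -
    have "comm_word (letter a) (letter b) \<in> comm_rels E" using that by (force simp: comm_rels_def)
    then have "pres_eq X (comm_rels E) (comm_word (letter a) (letter b)) []"
      using pres_eq.relator[of "[]" X "[]" _ "comm_rels E"] by simp
    then show ?thesis
      using that E by (subst (asm) pres_eq_comm_word_iff[OF R]) auto
  qed
  have 1: "pres_eq X (comm_rels E) (letter x @ letter y) (letter y @ letter x)"
    using assms(2) pos pres_eq.sym by metis
  have 2: "pres_eq X (comm_rels E) ([(x, s)] @ letter y) (letter y @ [(x, s)])"
    using 1 pres_eq_commute_inv[OF _ _ 1] XY by (cases s) (auto simp: letter_def inv_word_def)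
  have 3: "pres_eq X (comm_rels E) (inv_word (letter y) @ [(x, s)]) ([(x, s)] @ inv_word (letter y))"
    using pres_eq_commute_inv[OF _ _ pres_eq.sym[OF 2]] XY by simp
  show ?thesis
    using 2 pres_eq.sym[OF 3] by (cases t) (auto simp: letter_def inv_word_def)
qed

lemma comm_rels_commute:
  assumes E: "E \<subseteq> X \<times> X" and "u \<in> words X" "v \<in> words X"
    and "\<And>x y. \<lbrakk>x \<in> letters u; y \<in> letters v\<rbrakk> \<Longrightarrow> (x, y) \<in> E \<or> (y, x) \<in> E"
  shows "pres_eq X (comm_rels E) (u @ v) (v @ u)"
  using assms(2-)
proof (induction u)
  case Nil
  then show ?case by (auto intro: pres_eq.refl)
next
  case (Cons p u)
  obtain x s where p: "p = (x, s)" by (cases p)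
  have single: "pres_eq X (comm_rels E) ((x, s) # v) (v @ [(x, s)])"
    if "v \<in> words X" "\<And>y. y \<in> letters v \<Longrightarrow> (x, y) \<in> E \<or> (y, x) \<in> E" for v
    using that
  proof (induction v)
    case Nil
    then show ?case using Cons.prems by (auto simp: p intro: pres_eq.refl)
  next
    case (Cons q v)
    obtain y t where q: "q = (y, t)" by (cases q)
    have xy: "(x, y) \<in> E \<or> (y, x) \<in> E" using Cons.prems(2)[of y] by (simp add: q)
    have "pres_eq X (comm_rels E) ((x, s) # q # v) (q # (x, s) # v)"
      using pres_eq_context[OF comm_rels_swap[OF E xy], of "[]" v s t] Cons.prems by (simp add: q)
    also have "pres_eq X (comm_rels E) (q # (x, s) # v) (q # v @ [(x, s)])"
      using pres_eq_context[OF Cons.IH, of "[q]" "[]"] Cons.prems by simp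
    finally show ?case by simp
  qed
  have "pres_eq X (comm_rels E) (p # u @ v) (p # v @ u)"
    using pres_eq_context[OF Cons.IH, of "[p]" "[]"] Cons.prems by simp
  also have "pres_eq X (comm_rels E) (p # v @ u) (v @ p # u)"
    using pres_eq_context[OF single[of v], of "[]" u] Cons.prems by (simp add: p)
  finally show ?case by simp
qed

lemma comm_rels_subst_word:
  assumes E: "E \<subseteq> X \<times> X" and E': "E' \<subseteq> Y \<times> Y"
    and f: "\<And>x. x \<in> X \<Longrightarrow> f x \<in> words Y"
    and EE': "\<forall>(x, y)\<in>E. \<forall>x'\<in>letters (f x). \<forall>y'\<in>letters (f y). (x', y') \<in> E' \<or> (y', x') \<in> E'"
    and uv: "pres_eq X (comm_rels E) u v"
  shows "pres_eq Y (comm_rels E') (subst_word f u) (subst_word f v)"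
proof (rule pres_eq_subst_word[OF uv f])
  fix r assume "r \<in> comm_rels E"
  then obtain x y where r: "r = comm_word (letter x) (letter y)" and xy: "(x, y) \<in> E"
    by (auto simp: comm_rels_def)
  have fw: "f x \<in> words Y" "f y \<in> words Y" using xy E f by blast+
  have "pres_eq Y (comm_rels E') (comm_word (f x) (f y)) []"
    unfolding pres_eq_comm_word_iff[OF comm_rels_words[OF E'] fw]
    using EE' xy by (intro comm_rels_commute[OF E' fw]) blast
  then show "pres_eq Y (comm_rels E') (subst_word f r) []"
    by (simp add: r subst_word_comm_word)
qed

lemma comm_rels_delete_pair:
  assumes E: "E \<subseteq> X \<times> X" and w: "p @ (x, s) # m @ (x, \<not> s) # q \<in> words X"
    and m: "letters m \<subseteq> comm_with E x"
  shows "pres_eq X (comm_rels E) (p @ (x, s) # m @ (x, \<not> s) # q) (p @ m @ q)"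
proof -
  have "pres_eq X (comm_rels E) ([(x, s)] @ m) (m @ [(x, s)])"
    using w m by (intro comm_rels_commute[OF E]) (auto simp: comm_with_def)
  from pres_eq_context[OF this, of p "(x, \<not> s) # q"] w
  have "pres_eq X (comm_rels E) (p @ (x, s) # m @ (x, \<not> s) # q) ((p @ m) @ [(x, s), (x, \<not> s)] @ q)"
    by simp
  also have "pres_eq X (comm_rels E) \<dots> ((p @ m) @ q)"
    using w by (intro pres_eq.cancel) auto
  finally show ?thesis by simp
qed

section \<open>Pinches\<close>

text \<open>A partially commutative group \<open>G\<close> is an HNN extension with stable letter \<open>x\<close> whose associated
  subgroup \<open>L\<close> is generated by \<open>C\<close>, the generators commuting with \<open>x\<close>. Killing the generators
  outside \<open>C\<close> is a retraction \<open>\<rho>\<close> onto \<open>L\<close>, so \<open>h \<rho>(h)\<^sup>-\<^sup>1\<close> is a canonical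
  representative of \<open>h L\<close>. \<open>G\<close> acts from the right on normal forms
  \<open>k\<^sub>1 x\<^sup>\<plusminus>\<^sup>1 \<dots> k\<^sub>n x\<^sup>\<plusminus>\<^sup>1 h\<close> with \<open>\<rho>(k\<^sub>i) = 1\<close>, kept as a stack of pairs
  (the last one on top) together with \<open>h\<close>.\<close>

locale comm_rels_vertex =
  fixes X :: "'a set" and E :: "('a \<times> 'a) set" and x :: 'a
  assumes E: "E \<subseteq> X \<times> X" and x: "x \<in> X"
begin

abbreviation eqv (infix "\<approx>" 50) where
  "u \<approx> v \<equiv> pres_eq X (comm_rels E) u v"

abbreviation C :: "'a set" where
  "C \<equiv> comm_with E x"

definition proj :: "'a word \<Rightarrow> 'a word" where
  "proj w = filter (\<lambda>p. fst p \<in> C) w"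

text \<open>An arbitrary choice from each class, so that equal states of the action are equal as
  terms.\<close>

definition nf :: "'a word \<Rightarrow> 'a word" where
  "nf w = (SOME v. w \<approx> v)"

text \<open>Right multiplication by \<open>x^s\<close>: as \<rho>(h) commutes with \<open>x\<close>,
  the element \<open>h x^s\<close> is \<open>k x^s\<close> times \<rho>(h). If \<open>k\<close> is
  trivial and the top entry is some \<open>k0 x^-s\<close>, the two powers cancel and
  \<open>k0\<close> times \<rho>(h) remains.\<close>

definition step :: "bool \<Rightarrow> ('a word \<times> bool) list \<times> 'a word \<Rightarrow> ('a word \<times> bool) list \<times> 'a word" where
  "step s \<sigma> =
     (let st = fst \<sigma>; h = snd \<sigma>; k = nf (h @ inv_word (proj h)) in
      if k = nf [] \<and> st \<noteq> [] \<and> snd (hd st) = (\<not> s) then (tl st, nf (fst (hd st) @ proj h))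
      else ((k, s) # st, nf (proj h)))"

definition act :: "('a word \<times> bool) list \<times> 'a word \<Rightarrow> 'a \<times> bool \<Rightarrow> ('a word \<times> bool) list \<times> 'a word" where
  "act \<sigma> p = (if fst p = x then step (snd p) \<sigma> else (fst \<sigma>, nf (snd \<sigma> @ [p])))"

text \<open>Reducedness in Britton's sense: no trivial \<open>k\<close> between opposite powers of
  \<open>x\<close>. The words range over all of \<open>X\<close>, up to equality in the whole group,
  so the base group needs no equality of its own.\<close>

fun valid_stack :: "('a word \<times> bool) list \<Rightarrow> bool" where
  "valid_stack [] \<longleftrightarrow> True"
| "valid_stack ((k, s) # st) \<longleftrightarrow> k \<in> words X \<and> nf k = k \<and> proj k \<approx> [] \<and>
     (k = nf [] \<and> st \<noteq> [] \<longrightarrow> snd (hd st) = s) \<and> valid_stack st"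

definition valid :: "('a word \<times> bool) list \<times> 'a word \<Rightarrow> bool" where
  "valid \<sigma> \<longleftrightarrow> valid_stack (fst \<sigma>) \<and> snd \<sigma> \<in> words X \<and> nf (snd \<sigma>) = snd \<sigma>"

lemmas R = comm_rels_words[OF E]

lemma eqv_words: "u \<approx> v \<Longrightarrow> u \<in> words X \<and> v \<in> words X"
  using pres_eq_words[OF _ R] .

lemma eqv_append: "\<lbrakk>u \<approx> u'; v \<approx> v'\<rbrakk> \<Longrightarrow> u @ v \<approx> u' @ v'"
  using pres_eq_append[OF _ _ R] .

lemma nf_eqv: "w \<in> words X \<Longrightarrow> w \<approx> nf w"
  unfolding nf_def by (rule someI[of _ w]) (rule pres_eq.refl)

lemma nf_words [simp]: "w \<in> words X \<Longrightarrow> nf w \<in> words X"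
  using nf_eqv eqv_words by blast

lemma nf_cong: "u \<approx> v \<Longrightarrow> nf u = nf v"
  unfolding nf_def by (rule arg_cong[where f = Eps]) (auto intro: pres_eq.sym pres_eq.trans)

lemma nf_eq_iff: "\<lbrakk>u \<in> words X; v \<in> words X\<rbrakk> \<Longrightarrow> nf u = nf v \<longleftrightarrow> u \<approx> v"
  by (metis nf_cong nf_eqv pres_eq.sym pres_eq.trans)

lemma nf_nf [simp]: "w \<in> words X \<Longrightarrow> nf (nf w) = nf w"
  using nf_cong nf_eqv by metis

lemma proj_simps [simp]:
  "proj [] = []"
  "proj (u @ v) = proj u @ proj v"
  "proj (p # v) = (if fst p \<in> C then p # proj v else proj v)"
  "proj (proj u) = proj u"
  by (auto simp: proj_def)

lemma proj_words [simp]: "w \<in> words X \<Longrightarrow> proj w \<in> words X"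
  by (induction w) auto

lemma letters_proj: "letters (proj w) \<subseteq> C"
  by (auto simp: proj_def)

lemma proj_id: "letters w \<subseteq> C \<Longrightarrow> proj w = w"
  by (auto simp: proj_def filter_id_conv)

text \<open>Seen as a substitution, the projection is a homomorphism, since deleting letters
  respects the commutators.\<close>

lemma proj_eq_subst_word: "proj w = subst_word (\<lambda>y. if y \<in> C then letter y else []) w"
  by (induction w) (auto simp: letter_def inv_word_def)

lemma proj_cong: "u \<approx> v \<Longrightarrow> proj u \<approx> proj v"
  unfolding proj_eq_subst_word
  by (rule comm_rels_subst_word[OF E E]) (auto simp: letter_def split: if_splits)

lemma coset_rep_eqv_Nil_iff: "h \<in> words X \<Longrightarrow> nf (h @ inv_word (proj h)) = nf [] \<longleftrightarrow> h \<approx> proj h"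
  by (simp add: nf_eq_iff pres_eq_inv_word_iff[OF R])

lemma proj_coset_rep: "h \<in> words X \<Longrightarrow> proj (nf (h @ inv_word (proj h))) \<approx> []"
proof -
  assume h: "h \<in> words X"
  have "proj (nf (h @ inv_word (proj h))) \<approx> proj (h @ inv_word (proj h))"
    using h by (intro proj_cong pres_eq.sym[OF nf_eqv]) simp
  also have "proj (inv_word (proj h)) = inv_word (proj h)"
    using letters_proj[of h] by (intro proj_id) simp
  then have "proj (h @ inv_word (proj h)) = proj h @ inv_word (proj h)" by simp
  also have "\<dots> \<approx> []" using h by (intro pres_eq_inv_right) simp
  finally show ?thesis .
qed

section \<open>The action on stacks\<close>

lemma valid_step:
  assumes "valid \<sigma>"
  shows "valid (step s \<sigma>)"
proof -
  obtain st h where \<sigma>: "\<sigma> = (st, h)" by (cases \<sigma>)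
  have st: "valid_stack st" and h: "h \<in> words X" using assms by (auto simp: valid_def \<sigma>)
  show ?thesis
    using st h proj_coset_rep[OF h]
    by (cases st) (auto simp: valid_def step_def Let_def \<sigma>)
qed

lemma valid_act: "\<lbrakk>valid \<sigma>; fst p \<in> X\<rbrakk> \<Longrightarrow> valid (act \<sigma> p)"
  using valid_step by (auto simp: act_def) (auto simp: valid_def)

lemma valid_foldl_act: "\<lbrakk>valid \<sigma>; w \<in> words X\<rbrakk> \<Longrightarrow> valid (foldl act \<sigma> w)"
  by (induction w arbitrary: \<sigma>) (auto simp: valid_act)

text \<open>A pop is undone by pushing the same entry back, a push by popping it; validity of the
  stack rules out a second pop.\<close>

lemma step_step:
  assumes "valid \<sigma>"
  shows "step (\<not> s) (step s \<sigma>) = \<sigma>"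
proof -
  obtain st h where \<sigma>: "\<sigma> = (st, h)" by (cases \<sigma>)
  have st: "valid_stack st" and h: "h \<in> words X" "nf h = h" using assms by (auto simp: valid_def \<sigma>)
  define k where "k = nf (h @ inv_word (proj h))"
  show ?thesis
  proof (cases "k = nf [] \<and> st \<noteq> [] \<and> snd (hd st) = (\<not> s)")
    case True
    then obtain k0 st0 where st0: "st = (k0, \<not> s) # st0" by (cases st) auto
    have k0: "k0 \<in> words X" "nf k0 = k0" "proj k0 \<approx> []"
      "k0 = nf [] \<and> st0 \<noteq> [] \<longrightarrow> snd (hd st0) = (\<not> s)"
      using st by (auto simp: st0)
    have hp: "h \<approx> proj h" using True coset_rep_eqv_Nil_iff[OF h(1)] by (simp add: k_def)
    define h1 where "h1 = nf (k0 @ proj h)"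
    have 1: "step s \<sigma> = (st0, h1)"
      using True by (simp add: step_def Let_def \<sigma> st0 k_def h1_def)
    have h1w: "h1 \<in> words X" using h k0 by (simp add: h1_def)
    have h1: "h1 \<approx> k0 @ proj h" unfolding h1_def using h k0 by (intro pres_eq.sym[OF nf_eqv]) simp
    have ph1: "proj h1 \<approx> proj h"
    proof -
      have "proj h1 \<approx> proj k0 @ proj h" using proj_cong[OF h1] by simp
      also have "\<dots> \<approx> [] @ proj h" using h k0 by (intro eqv_append pres_eq.refl) auto
      finally show ?thesis by simp
    qed
    \<comment> \<open>As \<open>k0\<close> has trivial projection, \<open>h1\<close> is
      \<open>k0\<close> times its own projection, so its representative is \<open>k0\<close>
      again.\<close>
    have "h1 @ inv_word (proj h1) \<approx> k0"
    proof -
      have "h1 \<approx> k0 @ proj h1"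
      proof -
        note h1
        also have "k0 @ proj h \<approx> k0 @ proj h1"
          using k0 ph1 by (intro eqv_append pres_eq.refl pres_eq.sym[OF ph1])
        finally show ?thesis .
      qed
      then have "h1 @ inv_word (proj h1) \<approx> (k0 @ proj h1) @ inv_word (proj h1)"
        using h1w by (intro eqv_append pres_eq.refl) auto
      also have "(k0 @ proj h1) @ inv_word (proj h1) \<approx> k0"
        using pres_eq_cancel_inv_right[of k0 X "proj h1" "[]" "comm_rels E"] k0 h1w by simp
      finally show ?thesis .
    qed
    then have k1: "nf (h1 @ inv_word (proj h1)) = k0" using nf_cong k0(2) by metis
    have "nf (proj h1) = h" using nf_cong[OF ph1] nf_cong[OF hp] h by simp
    then show ?thesis
      using k0(4) k1 unfolding 1 by (auto simp: step_def Let_def \<sigma> st0)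
  next
    case False
    define l where "l = nf (proj h)"
    have 1: "step s \<sigma> = ((k, s) # st, l)"
      using False unfolding step_def Let_def \<sigma> k_def l_def by (auto simp del: nf_nf)
    have lw: "l \<in> words X" using h by (simp add: l_def)
    have l: "l \<approx> proj h" unfolding l_def using h by (intro pres_eq.sym[OF nf_eqv]) simp
    have pl: "proj l \<approx> proj h" using proj_cong[OF l] by simp
    have "l \<approx> proj l" using l pl pres_eq.sym pres_eq.trans by metis
    \<comment> \<open>\<open>l\<close> lies in the associated subgroup, so the entry just pushed is
      popped.\<close>
    then have k2: "nf (l @ inv_word (proj l)) = nf []" using coset_rep_eqv_Nil_iff[OF lw] by simp
    have "k @ proj l \<approx> (h @ inv_word (proj h)) @ proj h"
      unfolding k_def using h pl by (intro eqv_append pres_eq.sym[OF nf_eqv]) simp_all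
    also have "(h @ inv_word (proj h)) @ proj h \<approx> h"
      using pres_eq_cancel_inv_left[of h X "proj h" "[]" "comm_rels E"] h by simp
    finally have "nf (k @ proj l) = h" using nf_cong h(2) by metis
    then show ?thesis unfolding 1 using k2 by (auto simp: step_def Let_def \<sigma>)
  qed
qed

text \<open>Right multiplication by a letter of \<open>C\<close> keeps the coset of \<open>h\<close>
  and multiplies \<rho>(h) by that letter, so the same entry is pushed or popped.\<close>

lemma step_append_C:
  assumes "valid \<sigma>" and y: "y \<in> C"
  shows "step s (fst \<sigma>, nf (snd \<sigma> @ [(y, t)])) =
    (let \<tau> = step s \<sigma> in (fst \<tau>, nf (snd \<tau> @ [(y, t)])))"
proof -
  obtain st h where \<sigma>: "\<sigma> = (st, h)" by (cases \<sigma>)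
  have st: "valid_stack st" and h: "h \<in> words X" using assms by (auto simp: valid_def \<sigma>)
  have yX: "y \<in> X" using y E by (auto simp: comm_with_def)
  define h' where "h' = nf (h @ [(y, t)])"
  have h'w: "h' \<in> words X" using h yX by (simp add: h'_def)
  have h': "h' \<approx> h @ [(y, t)]" unfolding h'_def using h yX by (intro pres_eq.sym[OF nf_eqv]) simp
  have ph': "proj h' \<approx> proj h @ [(y, t)]" using proj_cong[OF h'] y by simp
  have rep: "nf (h' @ inv_word (proj h')) = nf (h @ inv_word (proj h))"
  proof -
    have "h \<approx> (h @ inv_word (proj h)) @ proj h"
      using pres_eq_cancel_inv_left[of h X "proj h" "[]" "comm_rels E"] h by (auto intro: pres_eq.sym)
    then have "h @ [(y, t)] \<approx> ((h @ inv_word (proj h)) @ proj h) @ [(y, t)]"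
      using yX by (intro eqv_append pres_eq.refl) auto
    with h' have "h' \<approx> ((h @ inv_word (proj h)) @ proj h) @ [(y, t)]" by (rule pres_eq.trans)
    also have "\<dots> \<approx> (h @ inv_word (proj h)) @ proj h'"
      using eqv_append[OF pres_eq.refl pres_eq.sym[OF ph'], of "h @ inv_word (proj h)"] h by simp
    finally have "h' @ inv_word (proj h') \<approx> ((h @ inv_word (proj h)) @ proj h') @ inv_word (proj h')"
      using h'w by (intro eqv_append pres_eq.refl) auto
    also have "\<dots> \<approx> h @ inv_word (proj h)"
      using pres_eq_cancel_inv_right[of "h @ inv_word (proj h)" X "proj h'" "[]" "comm_rels E"] h h'w
      by simp
    finally show ?thesis by (rule nf_cong)
  qed
  have push: "nf (proj h') = nf (nf (proj h) @ [(y, t)])"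
  proof (rule nf_cong)
    note ph'
    also have "proj h @ [(y, t)] \<approx> nf (proj h) @ [(y, t)]"
      using h yX by (intro eqv_append nf_eqv pres_eq.refl) auto
    finally show "proj h' \<approx> nf (proj h) @ [(y, t)]" .
  qed
  have pop: "nf (k @ proj h') = nf (nf (k @ proj h) @ [(y, t)])" if k: "k \<in> words X" for k
  proof (rule nf_cong)
    have "k @ proj h' \<approx> (k @ proj h) @ [(y, t)]"
      using eqv_append[OF pres_eq.refl[OF k] ph'] by simp
    also have "\<dots> \<approx> nf (k @ proj h) @ [(y, t)]"
      using h k yX by (intro eqv_append nf_eqv pres_eq.refl) auto
    finally show "k @ proj h' \<approx> nf (k @ proj h) @ [(y, t)]" .
  qed
  have "fst (hd st) \<in> words X" if "st \<noteq> []" using st that by (cases st) auto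
  then show ?thesis
    using push pop unfolding \<sigma> fst_conv snd_conv h'_def[symmetric]
    by (auto simp: step_def Let_def rep)
qed

lemma act_act_inv:
  assumes "valid \<sigma>" "y \<in> X"
  shows "act (act \<sigma> (y, s)) (y, \<not> s) = \<sigma>"
proof (cases "y = x")
  case True
  then show ?thesis using step_step[OF assms(1)] by (simp add: act_def)
next
  case False
  have h: "snd \<sigma> \<in> words X" "nf (snd \<sigma>) = snd \<sigma>" using assms by (auto simp: valid_def)
  have "nf (snd \<sigma> @ [(y, s)]) @ [(y, \<not> s)] \<approx> (snd \<sigma> @ [(y, s)]) @ [(y, \<not> s)]"
    using h assms by (intro eqv_append pres_eq.sym[OF nf_eqv] pres_eq.refl) auto
  also have "\<dots> \<approx> snd \<sigma>"
    using pres_eq.cancel[of "snd \<sigma>" X "[]" y "comm_rels E" s] h assms by simp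
  finally have "nf (nf (snd \<sigma> @ [(y, s)]) @ [(y, \<not> s)]) = snd \<sigma>" using nf_cong h by metis
  then show ?thesis using False by (simp add: act_def)
qed

lemma act_commute:
  assumes "valid \<sigma>" and yz: "(y, z) \<in> E"
  shows "act (act \<sigma> (y, s)) (z, s) = act (act \<sigma> (z, s)) (y, s)"
proof -
  have X: "y \<in> X" "z \<in> X" using yz E by auto
  have h: "snd \<sigma> \<in> words X" using assms by (auto simp: valid_def)
  have nfnf: "nf (nf (snd \<sigma> @ [(a, s)]) @ [(b, s)]) = nf (snd \<sigma> @ [(a, s), (b, s)])"
    if "a \<in> X" "b \<in> X" for a b
  proof (rule nf_cong)
    have "nf (snd \<sigma> @ [(a, s)]) @ [(b, s)] \<approx> (snd \<sigma> @ [(a, s)]) @ [(b, s)]"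
      using h that by (intro eqv_append pres_eq.sym[OF nf_eqv] pres_eq.refl) auto
    then show "nf (snd \<sigma> @ [(a, s)]) @ [(b, s)] \<approx> snd \<sigma> @ [(a, s), (b, s)]" by simp
  qed
  have swap: "nf (snd \<sigma> @ [(y, s), (z, s)]) = nf (snd \<sigma> @ [(z, s), (y, s)])"
    using eqv_append[OF pres_eq.refl[OF h] comm_rels_swap[OF E], of y z s s] yz by (intro nf_cong) simp
  consider "y = z" | "y \<noteq> x" "z \<noteq> x" | "y = x" "z \<in> C" | "z = x" "y \<in> C"
    using yz by (auto simp: comm_with_def)
  then show ?thesis
  proof cases
    case 2
    then show ?thesis using nfnf X swap by (simp add: act_def)
  next
    case 3
    then have "z \<noteq> x" by (simp add: comm_with_def)
    then show ?thesis using 3 step_append_C[OF assms(1) 3(2), of s s] by (simp add: act_def Let_def)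
  next
    case 4
    then have "y \<noteq> x" by (simp add: comm_with_def)
    then show ?thesis using 4 step_append_C[OF assms(1) 4(2), of s s] by (simp add: act_def Let_def)
  qed simp
qed

lemma foldl_act_cong:
  assumes "u \<approx> v" "valid \<sigma>"
  shows "foldl act \<sigma> u = foldl act \<sigma> v"
  using assms
proof (induction arbitrary: \<sigma>)
  case (cancel u v y s)
  then show ?case using act_act_inv[OF valid_foldl_act] by simp
next
  case (relator u v r)
  then obtain y z where r: "r = comm_word (letter y) (letter z)" and yz: "(y, z) \<in> E"
    by (auto simp: comm_rels_def)
  have X: "y \<in> X" "z \<in> X" using yz E by auto
  define \<tau> where "\<tau> = foldl act \<sigma> u"
  have \<tau>: "valid \<tau>" using relator valid_foldl_act by (simp add: \<tau>_def)
  have inv: "act (act \<rho> (a, False)) (a, True) = \<rho>" if "valid \<rho>" "a \<in> X" for \<rho> a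
    using act_act_inv[OF that, of False] by simp
  \<comment> \<open>Exchanging the last two letters turns \<open>y^-1 z^-1 y z\<close> into
    \<open>y^-1 z^-1 z y\<close>, which cancels.\<close>
  have "foldl act \<tau> r = \<tau>"
    using \<tau> X act_commute[OF _ yz, of "act (act \<tau> (y, False)) (z, False)" True]
    by (simp add: r comm_word_def letter_def inv_word_def inv valid_act)
  then show ?case by (simp add: \<tau>_def)
qed auto

section \<open>Britton's lemma\<close>

definition has_pinch :: "'a word \<Rightarrow> bool" where
  "has_pinch w \<longleftrightarrow>
     (\<exists>p s m q. w = p @ (x, s) # m @ (x, \<not> s) # q \<and> x \<notin> letters m \<and> m \<approx> proj m)"

lemma has_pinchI: "\<lbrakk>x \<notin> letters m; m \<approx> proj m\<rbrakk> \<Longrightarrow> has_pinch (p @ (x, s) # m @ (x, \<not> s) # q)"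
  unfolding has_pinch_def by (intro exI conjI) (rule HOL.refl)

lemma has_pinch_append:
  assumes "has_pinch w"
  shows "has_pinch (w @ v)"
proof -
  obtain p s m q where w: "w = p @ (x, s) # m @ (x, \<not> s) # q" and m: "x \<notin> letters m" "m \<approx> proj m"
    using assms unfolding has_pinch_def by blast
  show ?thesis using has_pinchI[OF m, of p s "q @ v"] by (simp add: w)
qed

text \<open>Reading a pinch-free word never pops, so every \<open>x\<close> stays on the stack. The
  factor \<open>c\<close> is the element of the associated subgroup that moved to the right of the
  last \<open>x\<close> when it was pushed.\<close>

lemma pinch_free_stack:
  assumes "w \<in> words X"
    and "\<not> has_pinch w"
  defines "\<sigma> \<equiv> foldl act ([], nf []) w"
  shows "(fst \<sigma> = [] \<longleftrightarrow> x \<notin> letters w) \<and>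
    (fst \<sigma> \<noteq> [] \<longrightarrow> (\<exists>p c m. w = p @ (x, snd (hd (fst \<sigma>))) # m \<and> x \<notin> letters m \<and>
      c \<in> words X \<and> letters c \<subseteq> C \<and> snd \<sigma> = nf (c @ m)))"
  using assms(1,2) unfolding \<sigma>_def
proof (induction w rule: rev_induct)
  case (snoc a w)
  obtain y s where a: "a = (y, s)" by (cases a)
  define \<sigma> where "\<sigma> = foldl act ([], nf []) w"
  have w: "w \<in> words X" and y: "y \<in> X" using snoc.prems(1) by (simp_all add: a)
  have "valid \<sigma>" unfolding \<sigma>_def using w by (intro valid_foldl_act) (simp_all add: valid_def)
  then have h: "snd \<sigma> \<in> words X" by (simp add: valid_def)
  have "\<not> has_pinch w" using snoc.prems(2) has_pinch_append by blast
  note IH = snoc.IH[OF w this, folded \<sigma>_def]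
  show ?case
  proof (cases "y = x")
    case True
    \<comment> \<open>A pop would need \<open>c @ m\<close> in the associated subgroup; as
      \<open>c\<close> lies there, so would \<open>m\<close>, and the new letter would close a
      pinch.\<close>
    have "\<not> (snd \<sigma> \<approx> proj (snd \<sigma>) \<and> fst \<sigma> \<noteq> [] \<and> snd (hd (fst \<sigma>)) = (\<not> s))"
    proof
      assume *: "snd \<sigma> \<approx> proj (snd \<sigma>) \<and> fst \<sigma> \<noteq> [] \<and> snd (hd (fst \<sigma>)) = (\<not> s)"
      then have ex: "\<exists>p c m. w = p @ (x, snd (hd (fst \<sigma>))) # m \<and> x \<notin> letters m \<and>
        c \<in> words X \<and> letters c \<subseteq> C \<and> snd \<sigma> = nf (c @ m)" using IH by blast
      have "snd (hd (fst \<sigma>)) = (\<not> s)" using * by blast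
      from ex[unfolded this] obtain p c m where w': "w = p @ (x, \<not> s) # m" and m: "x \<notin> letters m"
        and c: "c \<in> words X" "letters c \<subseteq> C" "snd \<sigma> = nf (c @ m)" by (elim exE conjE)
      have mw: "m \<in> words X" using w by (simp add: w')
      have "c @ m \<approx> snd \<sigma>" using c mw by (simp add: nf_eqv)
      also have "snd \<sigma> \<approx> proj (snd \<sigma>)" using * by simp
      also have "proj (snd \<sigma>) \<approx> proj (c @ m)"
        by (rule proj_cong[OF pres_eq.sym[OF \<open>c @ m \<approx> snd \<sigma>\<close>]])
      also have "proj (c @ m) = c @ proj m" using proj_id[OF c(2)] by simp
      finally have "m \<approx> proj m" by (rule pres_eq_append_left_cancel) (use c mw in auto)
      then have "has_pinch (w @ [a])" using has_pinchI[OF m, of p "\<not> s" "[]"] by (simp add: a w' True)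
      then show False using snoc.prems(2) by contradiction
    qed
    then have "step s \<sigma> = ((nf (snd \<sigma> @ inv_word (proj (snd \<sigma>))), s) # fst \<sigma>, nf (proj (snd \<sigma>)))"
      using coset_rep_eqv_Nil_iff[OF h] by (auto simp: step_def Let_def)
    then have eq: "foldl act ([], nf []) (w @ [a]) =
        ((nf (snd \<sigma> @ inv_word (proj (snd \<sigma>))), s) # fst \<sigma>, nf (proj (snd \<sigma>)))"
      by (simp add: act_def a True flip: \<sigma>_def)
    have "w @ [a] = w @ (x, s) # [] \<and> x \<notin> letters [] \<and> proj (snd \<sigma>) \<in> words X \<and>
        letters (proj (snd \<sigma>)) \<subseteq> C \<and> nf (proj (snd \<sigma>)) = nf (proj (snd \<sigma>) @ [])"
      using h letters_proj by (simp add: a True)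
    then have "\<exists>p c m. w @ [a] = p @ (x, s) # m \<and> x \<notin> letters m \<and>
        c \<in> words X \<and> letters c \<subseteq> C \<and> nf (proj (snd \<sigma>)) = nf (c @ m)" by (intro exI)
    moreover have "x \<in> letters (w @ [a])" by (simp add: a True)
    ultimately show ?thesis unfolding eq fst_conv snd_conv list.sel by simp
  next
    case False
    then have eq: "foldl act ([], nf []) (w @ [a]) = (fst \<sigma>, nf (snd \<sigma> @ [a]))"
      by (simp add: act_def a flip: \<sigma>_def)
    have "\<exists>p c m. w @ [a] = p @ (x, snd (hd (fst \<sigma>))) # m \<and> x \<notin> letters m \<and>
      c \<in> words X \<and> letters c \<subseteq> C \<and> nf (snd \<sigma> @ [a]) = nf (c @ m)" if "fst \<sigma> \<noteq> []"
    proof -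
      from IH that obtain p c m where *: "w = p @ (x, snd (hd (fst \<sigma>))) # m" "x \<notin> letters m"
        "c \<in> words X" "letters c \<subseteq> C" "snd \<sigma> = nf (c @ m)" by blast
      have "m \<in> words X" using w by (subst (asm) *(1)) simp
      then have "nf (c @ m) @ [a] \<approx> (c @ m) @ [a]"
        using * y by (intro eqv_append pres_eq.sym[OF nf_eqv] pres_eq.refl) (auto simp: a)
      then have "nf (snd \<sigma> @ [a]) = nf (c @ m @ [a])" using nf_cong * by simp
      then show ?thesis
        using * False by (intro exI[of _ p] exI[of _ c] exI[of _ "m @ [a]"]) (auto simp: a)
    qed
    moreover have "x \<in> letters (w @ [a]) \<longleftrightarrow> x \<in> letters w" using False by (simp add: a)
    ultimately show ?thesis using IH unfolding eq fst_conv snd_conv by simp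
  qed
qed simp

lemma foldl_act_avoiding:
  assumes "x \<notin> letters w"
  shows "fst (foldl act \<sigma> w) = fst \<sigma>"
  using assms by (induction w arbitrary: \<sigma>) (auto simp: act_def)

text \<open>Equal elements act equally on the empty stack. As \<open>v\<close> leaves it empty, so
  does \<open>u\<close>, which a pinch-free word containing \<open>x\<close> cannot do.\<close>

lemma pinch:
  assumes "u \<approx> v" "x \<notin> letters v" "x \<in> letters u"
  obtains p s m q where "u = p @ (x, s) # m @ (x, \<not> s) # q" "x \<notin> letters m" "m \<approx> proj m"
proof -
  have "valid ([], nf [])" by (simp add: valid_def)
  then have "fst (foldl act ([], nf []) u) = []"
    using foldl_act_cong[OF assms(1)] foldl_act_avoiding[OF assms(2)] by simp
  then show ?thesis
    using pinch_free_stack[of u] eqv_words[OF assms(1)] assms(3) that unfolding has_pinch_def by blast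
qed

end

section \<open>Reduced words\<close>

definition reduced :: "('a \<times> 'a) set \<Rightarrow> 'a word \<Rightarrow> bool" where
  "reduced E w \<longleftrightarrow>
     (\<nexists>p x s m q. w = p @ (x, s) # m @ (x, \<not> s) # q \<and> letters m \<subseteq> comm_with E x)"

lemma reducedD:
  assumes "reduced E (p @ (x, s) # m @ (x, \<not> s) # q)"
  shows "\<not> letters m \<subseteq> comm_with E x"
proof
  assume "letters m \<subseteq> comm_with E x"
  then have "\<exists>p' x' s' m' q'. p @ (x, s) # m @ (x, \<not> s) # q = p' @ (x', s') # m' @ (x', \<not> s') # q' \<and>
      letters m' \<subseteq> comm_with E x'"
    by (intro exI conjI) (rule HOL.refl)
  then show False using assms unfolding reduced_def by contradiction
qed

lemma reduced_infix:
  assumes "reduced E (p @ w @ q)"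
  shows "reduced E w"
  unfolding reduced_def
proof safe
  fix p' x s m q' assume "w = p' @ (x, s) # m @ (x, \<not> s) # q'" "letters m \<subseteq> comm_with E x"
  then show False using assms reducedD[of E "p @ p'" x s m "q' @ q"] by simp
qed

lemma reduced_pinch:
  assumes "reduced E (p @ (x, s) # m @ (x, \<not> s) # q)"
  shows "reduced E m" "\<not> letters m \<subseteq> comm_with E x"
  using assms reduced_infix[of E "p @ [(x, s)]" m "(x, \<not> s) # q"] reducedD[OF assms] by simp_all

lemma not_reduced_shorten:
  assumes E: "E \<subseteq> X \<times> X" and w: "w \<in> words X" "\<not> reduced E w"
  obtains w' where "pres_eq X (comm_rels E) w w'" "length w' < length w"
proof -
  from w(2) obtain p x s m q where "w = p @ (x, s) # m @ (x, \<not> s) # q" "letters m \<subseteq> comm_with E x"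
    unfolding reduced_def not_not by (elim exE conjE)
  then show ?thesis
    using comm_rels_delete_pair[OF E, of p x s m q] w(1) that[of "p @ m @ q"] by simp
qed

text \<open>The word is reduced with respect to \<open>E\<close> and evaluated in the group of
  \<open>E'\<close>. The first condition makes the next vertex the only later one that can block a
  cancellation at \<open>v\<close>; the second keeps it out of the generators of the associated
  subgroup.\<close>

fun noncomm_path :: "('a \<times> 'a) set \<Rightarrow> ('a \<times> 'a) set \<Rightarrow> 'a list \<Rightarrow> bool" where
  "noncomm_path E E' [] \<longleftrightarrow> True"
| "noncomm_path E E' (v # vs) \<longleftrightarrow> (\<forall>y\<in>set vs. y \<notin> comm_with E v \<longrightarrow> y = hd vs) \<and>
     (vs \<noteq> [] \<longrightarrow> hd vs \<notin> comm_with E' v) \<and> noncomm_path E E' vs"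

text \<open>A pinch at \<open>v\<close> contains the next vertex of the path, since the word is reduced, but its
  value does not involve that vertex. So it contains a pinch at the next vertex, and so on until
  the path ends.\<close>

lemma reduced_noncomm_path:
  assumes "E' \<subseteq> X \<times> X" "noncomm_path E E' (v # vs)" "reduced E w" "letters w \<subseteq> set (v # vs)"
    "pres_eq X (comm_rels E') w w'" "v \<notin> letters w'"
  shows "v \<notin> letters w"
  using assms(2-)
proof (induction vs arbitrary: v w w')
  case (Nil v w w')
  show ?case
  proof
    assume v: "v \<in> letters w"
    have "v \<in> X"
      using v pres_eq_words[OF Nil.prems(4) comm_rels_words[OF assms(1)]] by (auto simp: words_iff_letters)
    then interpret comm_rels_vertex X E' v using assms(1) by unfold_locales
    obtain p s m q where w: "w = p @ (v, s) # m @ (v, \<not> s) # q" and "v \<notin> letters m"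
      using pinch[OF Nil.prems(4,5) v] by metis
    then have "m = []" using Nil.prems(3) by (cases m) auto
    then show False using reduced_pinch(2)[OF Nil.prems(2)[unfolded w]] by simp
  qed
next
  case (Cons v' vs v w w')
  show ?case
  proof
    assume v: "v \<in> letters w"
    have "v \<in> X"
      using v pres_eq_words[OF Cons.prems(4) comm_rels_words[OF assms(1)]] by (auto simp: words_iff_letters)
    then interpret comm_rels_vertex X E' v using assms(1) by unfold_locales
    obtain p s m q where w: "w = p @ (v, s) # m @ (v, \<not> s) # q" and m: "v \<notin> letters m"
      "pres_eq X (comm_rels E') m (proj m)" using pinch[OF Cons.prems(4,5) v] by metis
    note red = reduced_pinch[OF Cons.prems(2)[unfolded w]]
    have lm: "letters m \<subseteq> set (v' # vs)" using Cons.prems(3) m(1) by (auto simp: w)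
    \<comment> \<open>Under \<open>E'\<close> the vertex \<open>v'\<close> does not commute with
      \<open>v\<close>, so the projection deletes it.\<close>
    have "v' \<notin> letters (proj m)" using Cons.prems(1) letters_proj[of m] by auto
    then have "v' \<notin> letters m" using Cons.IH[OF _ red(1) lm m(2)] Cons.prems(1) by simp
    moreover have "v' \<in> letters m" using red(2) lm Cons.prems(1) by auto
    ultimately show False by blast
  qed
qed

section \<open>The two groups\<close>

definition C5_comm :: "(c5_gen \<times> c5_gen) set" where
  "C5_comm = {(Ga, Gc), (Ga, Gd), (Gb, Gd), (Gb, Ge), (Gc, Ge)}"

definition P7_comm :: "(p7_gen \<times> p7_gen) set" where
  "P7_comm = {(Ha, Hc1), (Ha, Hc2), (Ha, Hd1), (Ha, Hd2), (Ha, He2),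
      (Hb, Hc1), (Hb, Hd1), (Hb, Hd2), (Hb, He1), (Hb, He2),
      (Hc1, Hc2), (Hc1, Hd2), (Hc1, He1), (Hc1, He2),
      (Hc2, Hd1), (Hc2, He1), (Hc2, He2),
      (Hd1, Hd2), (Hd1, He2), (Hd2, He1), (He1, He2)}"

text \<open>Since the generators exhaust the type, membership conditions on words become
  trivial.\<close>

lemma C5c_gens_UNIV: "C5c_gens = UNIV"
  by (auto simp: C5c_gens_def) (metis c5_gen.exhaust)

lemma P7c_gens_UNIV: "P7c_gens = UNIV"
  by (auto simp: P7c_gens_def) (metis p7_gen.exhaust)

lemma words_UNIV [simp]: "w \<in> words UNIV"
  by (simp add: words_iff_letters)

lemma C5c_rels_eq: "C5c_rels = comm_rels C5_comm"
  by (simp add: C5c_rels_def comm_rels_def C5_comm_def)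

lemma P7c_rels_eq: "P7c_rels = comm_rels P7_comm"
  by (simp add: P7c_rels_def comm_rels_def P7_comm_def)

fun lift_gen :: "c5_gen \<Rightarrow> p7_gen word" where
  "lift_gen Ga = letter Ha"
| "lift_gen Gb = letter Hb"
| "lift_gen Gc = letter Hc1 @ letter Hc2"
| "lift_gen Gd = letter Hd1 @ letter Hd2"
| "lift_gen Ge = letter He1 @ letter He2"

abbreviation lift_word :: "c5_gen word \<Rightarrow> p7_gen word" where
  "lift_word \<equiv> subst_word lift_gen"

text \<open>The retractions onto the subgroups of the subpaths \<open>a, b, c\<^sub>2, d\<^sub>2, e\<^sub>2\<close> and
  \<open>c\<^sub>1, d\<^sub>1, e\<^sub>1, a, b\<close>, read as quotients of the group of the 5-cycle.\<close>

fun fold_right :: "p7_gen \<Rightarrow> c5_gen word" where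
  "fold_right Ha = letter Ga"
| "fold_right Hb = letter Gb"
| "fold_right Hc2 = letter Gc"
| "fold_right Hd2 = letter Gd"
| "fold_right He2 = letter Ge"
| "fold_right _ = []"

fun fold_left :: "p7_gen \<Rightarrow> c5_gen word" where
  "fold_left Hc1 = letter Gc"
| "fold_left Hd1 = letter Gd"
| "fold_left He1 = letter Ge"
| "fold_left Ha = letter Ga"
| "fold_left Hb = letter Gb"
| "fold_left _ = []"

text \<open>An equality of words, not only of group elements: one copy of each lifted letter
  survives. So a reduced word is itself the word evaluated in the quotient.\<close>

lemma fold_right_lift [simp]: "subst_word fold_right (lift_word w) = w"
proof (induction w)
  case (Cons p w)
  obtain x s where "p = (x, s)" by (cases p)
  then show ?case using Cons by (cases x) (auto simp: letter_def inv_word_def)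
qed simp

lemma fold_left_lift [simp]: "subst_word fold_left (lift_word w) = w"
proof (induction w)
  case (Cons p w)
  obtain x s where "p = (x, s)" by (cases p)
  then show ?case using Cons by (cases x) (auto simp: letter_def inv_word_def)
qed simp

lemma lift_word_cong:
  "pres_eq UNIV (comm_rels C5_comm) u v \<Longrightarrow> pres_eq UNIV (comm_rels P7_comm) (lift_word u) (lift_word v)"
  by (rule comm_rels_subst_word[of _ UNIV])
    (simp_all add: C5_comm_def P7_comm_def letter_def)

text \<open>The added pair comes from the ends \<open>Ha\<close> and \<open>He2\<close> of the
  subpath, which commute although \<open>Ga\<close> and \<open>Ge\<close> are adjacent on the
  5-cycle.\<close>

lemma fold_right_cong:
  "pres_eq UNIV (comm_rels P7_comm) u v \<Longrightarrow>
   pres_eq UNIV (comm_rels (insert (Ga, Ge) C5_comm)) (subst_word fold_right u) (subst_word fold_right v)"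
  by (rule comm_rels_subst_word[of P7_comm UNIV])
    (simp_all add: C5_comm_def P7_comm_def letter_def)

text \<open>Here the commuting ends of the subpath are \<open>Hc1\<close> and
  \<open>Hb\<close>.\<close>

lemma fold_left_cong:
  "pres_eq UNIV (comm_rels P7_comm) u v \<Longrightarrow>
   pres_eq UNIV (comm_rels (insert (Gb, Gc) C5_comm)) (subst_word fold_left u) (subst_word fold_left v)"
  by (rule comm_rels_subst_word[of P7_comm UNIV])
    (simp_all add: C5_comm_def P7_comm_def letter_def)

text \<open>\<open>Ha\<close> occurs in the image of \<open>Ga\<close> alone, as its sole letter, so
  a cut there never splits the image of a letter. Thus a pinch at \<open>Ha\<close> is the image of
  a subword.\<close>

lemma lift_word_split_at_a:
  assumes "lift_word w = P @ (Ha, s) # Q"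
  obtains p q where "w = p @ (Ga, s) # q" "P = lift_word p" "Q = lift_word q"
  using assms
proof (induction w arbitrary: P thesis)
  case (Cons y w)
  obtain x t where y: "y = (x, t)" by (cases y)
  define u where "u = (if t then lift_gen x else inv_word (lift_gen x))"
  have eq: "u @ lift_word w = P @ (Ha, s) # Q" using Cons.prems(2) by (simp add: y u_def)
  have lift_y: "lift_word (y # p) = u @ lift_word p" for p by (simp add: y u_def)
  from eq consider us where "u = P @ us" "us @ lift_word w = (Ha, s) # Q"
    | us where "P = u @ us" "lift_word w = us @ (Ha, s) # Q"
    by (auto simp: append_eq_append_conv2)
  then consider us where "P = u @ us" "lift_word w = us @ (Ha, s) # Q"
    | us where "u = P @ (Ha, s) # us" "Q = us @ lift_word w"
  proof cases
    case (1 us)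
    \<comment> \<open>With \<open>us\<close> empty, the letter starts the image of the remaining
      word; otherwise it lies in the image \<open>u\<close> of the first letter.\<close>
    then show thesis using that(1)[of "[]"] that(2)[of "tl us"] by (cases us) simp_all
  next
    case (2 us)
    then show thesis by (rule that(1))
  qed
  then show ?case
  proof cases
    case 1
    obtain p q where "w = p @ (Ga, s) # q" "us = lift_word p" "Q = lift_word q"
      using Cons.IH[OF _ 1(2)] by metis
    then show ?thesis using Cons.prems(1)[of "y # p" q] 1 lift_y by simp
  next
    case 2
    then have "x = Ga \<and> s = t \<and> P = [] \<and> us = []"
      by (cases x; cases t)
        (auto simp: u_def letter_def inv_word_def Cons_eq_append_conv)
    then show ?thesis using Cons.prems(1)[of "[]" w] 2 by (simp add: y)
  qed
qed simp

section \<open>Triviality of the kernel\<close>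

lemma reduced_lift_trivial:
  assumes red: "reduced C5_comm w" and triv: "pres_eq UNIV (comm_rels P7_comm) (lift_word w) []"
  shows "w = []"
proof -
  note path_defs = comm_with_def C5_comm_def
  have gens: "A \<subseteq> {Ga, Gb, Gc, Gd, Ge}" for A
    using C5c_gens_UNIV unfolding C5c_gens_def by blast
  have remove: "A \<subseteq> insert v B \<Longrightarrow> v \<notin> A \<Longrightarrow> A \<subseteq> B" for A B :: "c5_gen set" and v
    by blast
  have "Ga \<notin> letters w"
  proof
    assume "Ga \<in> letters w"
    then have "Ha \<in> letters (lift_word w)"
      by (force simp: letters_subst_word letter_def)
    interpret comm_rels_vertex UNIV P7_comm Ha by unfold_locales auto
    obtain P s M Q where split: "lift_word w = P @ (Ha, s) # M @ (Ha, \<not> s) # Q"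
      and M: "Ha \<notin> letters M" "pres_eq UNIV (comm_rels P7_comm) M (proj M)"
      by (rule pinch[OF triv _ \<open>Ha \<in> letters (lift_word w)\<close>]) simp
    obtain p r where w: "w = p @ (Ga, s) # r" and split': "M @ (Ha, \<not> s) # Q = lift_word r"
      using lift_word_split_at_a[OF split] .
    obtain m q where r: "r = m @ (Ga, \<not> s) # q" and m: "M = lift_word m"
      using lift_word_split_at_a[OF split'[symmetric]] .
    note red_m = reduced_pinch[OF red[unfolded w r]]
    have a: "Ga \<notin> letters m"
      using M(1) by (force simp: m letters_subst_word letter_def)
    have m_gens: "letters m \<subseteq> {Gb, Gc, Gd, Ge}" using gens a by (rule remove)
    \<comment> \<open>The path neighbours \<open>Hb\<close> and \<open>He1\<close> of
      \<open>Ha\<close> are missing, so the value of \<open>M\<close> avoids \<open>Gb\<close> after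
      folding right and \<open>Ge\<close> after folding left.\<close>
    have "comm_with P7_comm Ha \<subseteq> {Hc1, Hc2, Hd1, Hd2, He2}"
      by (auto simp: comm_with_def P7_comm_def)
    with letters_proj have proj_M: "letters (proj M) \<subseteq> {Hc1, Hc2, Hd1, Hd2, He2}"
      by (rule subset_trans)
    have b: "Gb \<notin> letters m"
    proof (rule reduced_noncomm_path[where vs = "[Gc, Gd, Ge]" and E' = "insert (Ga, Ge) C5_comm"])
      show "letters m \<subseteq> set [Gb, Gc, Gd, Ge]" using m_gens by simp
      show "pres_eq UNIV (comm_rels (insert (Ga, Ge) C5_comm)) m (subst_word fold_right (proj M))"
        using fold_right_cong[OF M(2)] by (simp add: m)
      show "Gb \<notin> letters (subst_word fold_right (proj M))"
        using proj_M by (auto simp: letters_subst_word letter_def)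
    qed (use red_m(1) in \<open>auto simp: path_defs\<close>)
    have m_gens': "letters m \<subseteq> {Gc, Gd, Ge}" using m_gens b by (rule remove)
    \<comment> \<open>With \<open>Gb\<close> excluded, the path \<open>Ge\<close>,
      \<open>Gd\<close>, \<open>Gc\<close> carries all letters of \<open>m\<close>, and the added
      pair \<open>(Gb, Gc)\<close> joins no two of its vertices.\<close>
    have "Ge \<notin> letters m"
    proof (rule reduced_noncomm_path[where vs = "[Gd, Gc]" and E' = "insert (Gb, Gc) C5_comm"])
      show "letters m \<subseteq> set [Ge, Gd, Gc]" using m_gens' by (simp add: insert_commute)
      show "pres_eq UNIV (comm_rels (insert (Gb, Gc) C5_comm)) m (subst_word fold_left (proj M))"
        using fold_left_cong[OF M(2)] by (simp add: m)
      show "Ge \<notin> letters (subst_word fold_left (proj M))"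
        using proj_M by (auto simp: letters_subst_word letter_def)
    qed (use red_m(1) in \<open>auto simp: path_defs\<close>)
    \<comment> \<open>Both cycle neighbours of \<open>Ga\<close> are gone, so the two letters around
      \<open>m\<close> would cancel in \<open>w\<close>.\<close>
    then have "letters m \<subseteq> {Gc, Gd}"
      using m_gens' by (intro remove[of "letters m" Ge "{Gc, Gd}"]) (simp_all add: insert_commute)
    also have "\<dots> \<subseteq> comm_with C5_comm Ga" by (simp add: path_defs)
    finally show False using red_m(2) by contradiction
  qed
  \<comment> \<open>The value of \<open>w\<close> is trivial and avoids every vertex, so each
    remaining vertex can head the path in turn.\<close>
  have eq: "pres_eq UNIV (comm_rels (insert (Ga, Ge) C5_comm)) w []"
    using fold_right_cong[OF triv] by simp
  have *: "v \<notin> letters w" if "noncomm_path C5_comm (insert (Ga, Ge) C5_comm) (v # vs)"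
    "letters w \<subseteq> set (v # vs)" for v vs
    using reduced_noncomm_path[OF _ that(1) red that(2) eq] by simp
  have b: "letters w \<subseteq> {Gb, Gc, Gd, Ge}" using gens \<open>Ga \<notin> letters w\<close> by (rule remove)
  then have "Gb \<notin> letters w" by (intro *[of Gb "[Gc, Gd, Ge]"]) (simp_all add: path_defs)
  with b have c: "letters w \<subseteq> {Gc, Gd, Ge}" by (rule remove)
  then have "Gc \<notin> letters w" by (intro *[of Gc "[Gd, Ge]"]) (simp_all add: path_defs)
  with c have d: "letters w \<subseteq> {Gd, Ge}" by (rule remove)
  then have "Gd \<notin> letters w" by (intro *[of Gd "[Ge]"]) (simp_all add: path_defs)
  with d have e: "letters w \<subseteq> {Ge}" by (rule remove)
  then have "Ge \<notin> letters w" by (intro *[of Ge "[]"]) (simp_all add: path_defs)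
  with e have "letters w \<subseteq> {}" by (rule remove)
  then show "w = []" by simp
qed

text \<open>Deleting cancelling pairs shortens a word without changing its class, which leaves the
  reduced case.\<close>

lemma lift_word_trivial:
  assumes "pres_eq UNIV (comm_rels P7_comm) (lift_word w) []"
  shows "pres_eq UNIV (comm_rels C5_comm) w []"
  using assms
proof (induction "length w" arbitrary: w rule: less_induct)
  case less
  show ?case
  proof (cases "reduced C5_comm w")
    case True
    then show ?thesis using reduced_lift_trivial[OF True less.prems] by (simp add: pres_eq.refl)
  next
    case False
    then obtain w' where w': "pres_eq UNIV (comm_rels C5_comm) w w'" "length w' < length w"
      using not_reduced_shorten[of C5_comm UNIV w] by auto
    have "pres_eq UNIV (comm_rels P7_comm) (lift_word w') (lift_word w)"
      using lift_word_cong[OF w'(1)] by (rule pres_eq.sym)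
    then have "pres_eq UNIV (comm_rels P7_comm) (lift_word w') []"
      using less.prems by (rule pres_eq.trans)
    then show ?thesis using less.hyps[OF w'(2)] w'(1) pres_eq.trans by metis
  qed
qed

lemma lift_word_eq_iff:
  "pres_eq UNIV (comm_rels P7_comm) (lift_word u) (lift_word v) \<longleftrightarrow>
   pres_eq UNIV (comm_rels C5_comm) u v"
proof
  assume "pres_eq UNIV (comm_rels P7_comm) (lift_word u) (lift_word v)"
  then have "pres_eq UNIV (comm_rels P7_comm) (lift_word (u @ inv_word v)) []"
    by (simp add: pres_eq_inv_word_iff subst_word_inv_word subset_iff)
  then have "pres_eq UNIV (comm_rels C5_comm) (u @ inv_word v) []" by (rule lift_word_trivial)
  then show "pres_eq UNIV (comm_rels C5_comm) u v"
    by (simp add: pres_eq_inv_word_iff subset_iff)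
qed (rule lift_word_cong)

theorem proposition4p3:
  shows "\<exists>\<phi>\<in>mon G_C5c G_P7c.
      \<phi> (gen_C5c Ga) = gen_P7c Ha \<and>
      \<phi> (gen_C5c Gb) = gen_P7c Hb \<and>
      \<phi> (gen_C5c Gc) = gen_P7c Hc1 \<otimes>\<^bsub>G_P7c\<^esub> gen_P7c Hc2 \<and>
      \<phi> (gen_C5c Gd) = gen_P7c Hd1 \<otimes>\<^bsub>G_P7c\<^esub> gen_P7c Hd2 \<and>
      \<phi> (gen_C5c Ge) = gen_P7c He1 \<otimes>\<^bsub>G_P7c\<^esub> gen_P7c He2"
proof -
  define cls where "cls w = pres_rel UNIV (comm_rels C5_comm) `` {w}" for w
  define cls' where "cls' w = pres_rel UNIV (comm_rels P7_comm) `` {w}" for w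
  \<comment> \<open>By \<open>lift_word_cong\<close> the value does not depend on the chosen
    representative.\<close>
  define \<phi> where "\<phi> A = cls' (lift_word (SOME w. w \<in> A))" for A
  have R: "comm_rels C5_comm \<subseteq> words UNIV" "comm_rels P7_comm \<subseteq> words UNIV" by auto
  have cls_eq: "cls u = cls v \<longleftrightarrow> pres_eq UNIV (comm_rels C5_comm) u v" for u v
    using eq_equiv_class_iff[OF equiv_pres_rel[OF R(1)]] by (simp add: cls_def) (simp add: pres_rel_def)
  have cls'_eq: "cls' u = cls' v \<longleftrightarrow> pres_eq UNIV (comm_rels P7_comm) u v" for u v
    using eq_equiv_class_iff[OF equiv_pres_rel[OF R(2)]] by (simp add: cls'_def) (simp add: pres_rel_def)
  have car: "carrier G_C5c = range cls" "carrier G_P7c = range cls'"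
    by (auto simp: G_C5c_def G_P7c_def presented_group_def quotient_def cls_def cls'_def
        C5c_gens_UNIV P7c_gens_UNIV C5c_rels_eq P7c_rels_eq)
  have mult: "cls u \<otimes>\<^bsub>G_C5c\<^esub> cls v = cls (u @ v)" for u v
    using mult_presented_group[OF R(1)] by (simp add: G_C5c_def cls_def C5c_gens_UNIV C5c_rels_eq)
  have mult': "cls' u \<otimes>\<^bsub>G_P7c\<^esub> cls' v = cls' (u @ v)" for u v
    using mult_presented_group[OF R(2)] by (simp add: G_P7c_def cls'_def P7c_gens_UNIV P7c_rels_eq)
  have gen: "gen_C5c x = cls (letter x)" for x
    by (simp add: pres_gen_def cls_def C5c_gens_UNIV C5c_rels_eq)
  have gen': "gen_P7c x = cls' (letter x)" for x
    by (simp add: pres_gen_def cls'_def P7c_gens_UNIV P7c_rels_eq)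
  have \<phi>: "\<phi> (cls w) = cls' (lift_word w)" for w
  proof -
    have "w \<in> cls w" by (simp add: cls_def pres_rel_def pres_eq.refl)
    then have "(SOME v. v \<in> cls w) \<in> cls w" by (rule someI)
    then have "pres_eq UNIV (comm_rels C5_comm) w (SOME v. v \<in> cls w)"
      by (simp add: cls_def pres_rel_def)
    then show ?thesis unfolding \<phi>_def cls'_eq by (rule lift_word_cong[OF pres_eq.sym])
  qed
  have "\<phi> \<in> mon G_C5c G_P7c"
    by (auto simp: mon_def hom_def inj_on_def car mult mult' \<phi> cls_eq cls'_eq lift_word_eq_iff)
  moreover have "\<phi> (gen_C5c x) = cls' (lift_gen x)" for x
    by (simp add: gen \<phi>) (simp add: letter_def)
  ultimately show ?thesis by (intro bexI[of _ \<phi>]) (simp_all add: gen' mult')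
qed

end
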